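(* Let $K$ be a field of characteristic $0$, and let $\mathcal{A}s_3\langle X\rangle$ be the free third-type associative algebra over $K$ generated by the set $X$. Let $\mathcal{A}s_3^{(-)}\langle X\rangle$ be the same vector space with the commutator operation $[a,b]=ab-ba$. Then all identities of the algebra $\mathcal{A}s_3^{(-)}\langle X\rangle$ up to degree $4$ follow from anti-commutativity $[a,b]=-[b,a]$, the Jacobi identity $[[a,b],c]+[[b,c],a]+[[c,a],b]=0$, and the following identity (all of which hold in $\mathcal{A}s_3^{(-)}\langle X\rangle$): $$[[[a,b],c],d]=0.$$
   Context: A third-type associative algebra is an associative (not necessarily unital) $K$-algebra satisfying the identity $abc+bac-bca-cba=0$; $\mathcal{A}s_3$ is the variety of all such algebras and $\mathcal{A}s_3\langle X\rangle$ is the free algebra of this variety generated by the set $X$. An identity of an algebra with one bilinear operation $[\cdot,\cdot]$ is an element $f$ of the free nonassociative (magmatic) algebra in that operation that vanishes under every substitution of elements of the algebra for the variables. An identity follows from given identities if it lies in the ideal of the free nonassociative algebra, closed under all substitutions (T-ideal), generated by them.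
   Formalization: The claim that all identities up to degree 4 follow from the listed ones is stated for sets X with at least two elements; for |X| ≤ 1 it is false, since the free algebra is then commutative and [a,b]=0 is an identity that does not follow. *)

theory Defs
  imports Complex_Main "HOL-Library.Poly_Mapping"
begin

section \<open>Free nonassociative algebras\<close>

text \<open>Nonassociative monomials, i.e. elements of the free magma (without unit).\<close>

datatype 'v magma = Var 'v | Mul "'v magma" "'v magma"

primrec mdegree :: "'v magma \<Rightarrow> nat" where
  "mdegree (Var v) = 1"
| "mdegree (Mul s t) = mdegree s + mdegree t"

primrec eval_magma :: "('a \<Rightarrow> 'a \<Rightarrow> 'a) \<Rightarrow> ('v \<Rightarrow> 'a) \<Rightarrow> 'v magma \<Rightarrow> 'a" where
  "eval_magma mult \<sigma> (Var v) = \<sigma> v"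
| "eval_magma mult \<sigma> (Mul s t) = mult (eval_magma mult \<sigma> s) (eval_magma mult \<sigma> t)"

text \<open>
  The free nonassociative algebra over \<open>'k\<close> on the set of generators \<open>UNIV :: 'v set\<close>
  has the monomials as a basis. Its product is not the convolution product \<open>*\<close> of
  \<open>Poly_Mapping\<close>, which would require a monoid of exponents.
\<close>

type_synonym ('v, 'k) nonassoc = "'v magma \<Rightarrow>\<^sub>0 'k"

definition na_scale :: "'k::field \<Rightarrow> ('v, 'k) nonassoc \<Rightarrow> ('v, 'k) nonassoc" where
  "na_scale c f = Poly_Mapping.map ((*) c) f"

definition na_mult :: "('v, 'k::field) nonassoc \<Rightarrow> ('v, 'k) nonassoc \<Rightarrow> ('v, 'k) nonassoc"
    (infixl \<open>\<odot>\<close> 70) where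
  "f \<odot> g = (\<Sum>s\<in>Poly_Mapping.keys f. \<Sum>t\<in>Poly_Mapping.keys g.
     Poly_Mapping.single (Mul s t) (Poly_Mapping.lookup f s * Poly_Mapping.lookup g t))"

definition na_var :: "'v \<Rightarrow> ('v, 'k::field) nonassoc" where
  "na_var v = Poly_Mapping.single (Var v) 1"

lemma lookup_na_scale [simp]: "Poly_Mapping.lookup (na_scale c f) t = c * Poly_Mapping.lookup f t"
  by (simp add: na_scale_def Poly_Mapping.map.rep_eq when_def)

interpretation nonassoc: vector_space na_scale
  by unfold_locales
     (auto intro!: poly_mapping_eqI simp: lookup_add algebra_simps)

text \<open>
  The value of a nonassociative polynomial \<open>f\<close> in an algebra with the given scalar
  multiplication and bilinear operation, when \<open>\<sigma> v\<close> is substituted for the variable \<open>v\<close>.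
\<close>

definition na_eval ::
  "('k::field \<Rightarrow> 'a::ab_group_add \<Rightarrow> 'a) \<Rightarrow> ('a \<Rightarrow> 'a \<Rightarrow> 'a) \<Rightarrow> ('v \<Rightarrow> 'a) \<Rightarrow> ('v, 'k) nonassoc \<Rightarrow> 'a"
  where "na_eval scale mult \<sigma> f =
    (\<Sum>t\<in>Poly_Mapping.keys f. scale (Poly_Mapping.lookup f t) (eval_magma mult \<sigma> t))"

definition is_identity ::
  "('k::field \<Rightarrow> 'a::ab_group_add \<Rightarrow> 'a) \<Rightarrow> ('a \<Rightarrow> 'a \<Rightarrow> 'a) \<Rightarrow> ('v, 'k) nonassoc \<Rightarrow> bool"
  where "is_identity scale mult f \<longleftrightarrow> (\<forall>\<sigma>. na_eval scale mult \<sigma> f = 0)"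

definition is_ideal :: "('v, 'k::field) nonassoc set \<Rightarrow> bool" where
  "is_ideal J \<longleftrightarrow> nonassoc.subspace J \<and> (\<forall>f\<in>J. \<forall>g. f \<odot> g \<in> J \<and> g \<odot> f \<in> J)"

definition ideal_generated :: "('v, 'k::field) nonassoc set \<Rightarrow> ('v, 'k) nonassoc set" where
  "ideal_generated S = \<Inter>{J. is_ideal J \<and> S \<subseteq> J}"

definition is_T_ideal :: "('v, 'k::field) nonassoc set \<Rightarrow> bool" where
  "is_T_ideal J \<longleftrightarrow> is_ideal J \<and>
     (\<forall>\<sigma> :: 'v \<Rightarrow> ('v, 'k) nonassoc. \<forall>f\<in>J. na_eval na_scale (\<odot>) \<sigma> f \<in> J)"

definition T_ideal_generated :: "('v, 'k::field) nonassoc set \<Rightarrow> ('v, 'k) nonassoc set" where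
  "T_ideal_generated S = \<Inter>{J. is_T_ideal J \<and> S \<subseteq> J}"

lemma is_ideal_ideal_generated: "is_ideal (ideal_generated S)"
  by (auto simp: is_ideal_def ideal_generated_def intro!: nonassoc.subspace_Inter)

lemma ideal_generated_superset: "S \<subseteq> ideal_generated S"
  by (auto simp: ideal_generated_def)

lemma ideal_generated_minimal: "is_ideal J \<Longrightarrow> S \<subseteq> J \<Longrightarrow> ideal_generated S \<subseteq> J"
  by (auto simp: ideal_generated_def)

lemma na_mult_alt:
  assumes "finite A" "Poly_Mapping.keys f \<subseteq> A" "finite B" "Poly_Mapping.keys g \<subseteq> B"
  shows "f \<odot> g = (\<Sum>s\<in>A. \<Sum>t\<in>B. Poly_Mapping.single (Mul s t) (Poly_Mapping.lookup f s * Poly_Mapping.lookup g t))"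
proof -
  have "f \<odot> g = (\<Sum>s\<in>A. \<Sum>t\<in>Poly_Mapping.keys g. Poly_Mapping.single (Mul s t) (Poly_Mapping.lookup f s * Poly_Mapping.lookup g t))"
    unfolding na_mult_def by (rule sum.mono_neutral_left) (use assms in \<open>auto simp: in_keys_iff\<close>)
  also have "\<dots> = (\<Sum>s\<in>A. \<Sum>t\<in>B. Poly_Mapping.single (Mul s t) (Poly_Mapping.lookup f s * Poly_Mapping.lookup g t))"
    by (intro sum.cong refl sum.mono_neutral_left) (use assms in \<open>auto simp: in_keys_iff\<close>)
  finally show ?thesis .
qed

lemma na_mult_add_left: "(f + g) \<odot> h = f \<odot> h + g \<odot> h"
proof -
  let ?A = "Poly_Mapping.keys f \<union> Poly_Mapping.keys g"
  have "Poly_Mapping.keys (f + g) \<subseteq> ?A" by (rule Poly_Mapping.keys_add)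
  then show ?thesis
    by (simp add: na_mult_alt[of ?A _ "Poly_Mapping.keys h"] lookup_add distrib_right single_add sum.distrib)
qed

lemma na_mult_add_right: "h \<odot> (f + g) = h \<odot> f + h \<odot> g"
proof -
  let ?A = "Poly_Mapping.keys f \<union> Poly_Mapping.keys g"
  have "Poly_Mapping.keys (f + g) \<subseteq> ?A" by (rule Poly_Mapping.keys_add)
  then show ?thesis
    by (simp add: na_mult_alt[of "Poly_Mapping.keys h" _ ?A] lookup_add distrib_left single_add sum.distrib)
qed

lemma na_scale_single: "na_scale c (Poly_Mapping.single t a) = Poly_Mapping.single t (c * a)"
  by (rule poly_mapping_eqI) (simp add: lookup_single when_def)

lemma na_mult_scale_left: "na_scale c f \<odot> g = na_scale c (f \<odot> g)"
proof -
  have "Poly_Mapping.keys (na_scale c f) \<subseteq> Poly_Mapping.keys f" by (auto simp: in_keys_iff)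
  then show ?thesis
    by (simp add: na_mult_alt[of "Poly_Mapping.keys f" _ "Poly_Mapping.keys g"] nonassoc.scale_sum_right na_scale_single mult.assoc)
qed

lemma na_mult_scale_right: "f \<odot> na_scale c g = na_scale c (f \<odot> g)"
proof -
  have "Poly_Mapping.keys (na_scale c g) \<subseteq> Poly_Mapping.keys g" by (auto simp: in_keys_iff)
  then show ?thesis
    by (simp add: na_mult_alt[of "Poly_Mapping.keys f" _ "Poly_Mapping.keys g"] nonassoc.scale_sum_right na_scale_single ac_simps)
qed

lemma na_mult_zero_left [simp]: "0 \<odot> f = 0" and na_mult_zero_right [simp]: "f \<odot> 0 = 0"
  by (simp_all add: na_mult_def)

lemma na_mult_minus_left: "(- f) \<odot> g = - (f \<odot> g)"
  by (metis add.right_inverse add_eq_0_iff na_mult_add_left na_mult_zero_left)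

lemma na_mult_minus_right: "f \<odot> (- g) = - (f \<odot> g)"
  by (metis add.right_inverse add_eq_0_iff na_mult_add_right na_mult_zero_right)

lemma na_mult_diff_left: "(f - g) \<odot> h = f \<odot> h - g \<odot> h"
  using na_mult_add_left[of f "- g" h] by (simp add: na_mult_minus_left)

lemma na_mult_diff_right: "h \<odot> (f - g) = h \<odot> f - h \<odot> g"
  using na_mult_add_right[of h f "- g"] by (simp add: na_mult_minus_right)

section \<open>The free third-type associative algebra\<close>

text \<open>
  The free algebra of the variety on the generating set \<open>UNIV :: 'x set\<close> is the quotient of
  the free nonassociative algebra by the ideal generated by all values of the defining
  identities, associativity and \<open>abc + bac - bca - cba = 0\<close>.
\<close>

definition as3_relators :: "('x, 'k::field) nonassoc set" where
  "as3_relators =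
     {a \<odot> b \<odot> c - a \<odot> (b \<odot> c) | a b c. True} \<union>
     {a \<odot> b \<odot> c + b \<odot> a \<odot> c - b \<odot> c \<odot> a - c \<odot> b \<odot> a | a b c. True}"

definition as3_ideal :: "('x, 'k::field) nonassoc set" where
  "as3_ideal = ideal_generated as3_relators"

definition as3_rel :: "('x, 'k::field) nonassoc \<Rightarrow> ('x, 'k) nonassoc \<Rightarrow> bool" where
  "as3_rel f g \<longleftrightarrow> f - g \<in> as3_ideal"

lemma is_ideal_as3_ideal: "is_ideal as3_ideal"
  unfolding as3_ideal_def by (rule is_ideal_ideal_generated)

lemma
  fixes f g :: "('a, 'b::field) nonassoc"
  shows as3_ideal_0: "0 \<in> (as3_ideal :: ('a, 'b) nonassoc set)"
    and as3_ideal_add: "f \<in> as3_ideal \<Longrightarrow> g \<in> as3_ideal \<Longrightarrow> f + g \<in> as3_ideal"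
    and as3_ideal_diff: "f \<in> as3_ideal \<Longrightarrow> g \<in> as3_ideal \<Longrightarrow> f - g \<in> as3_ideal"
    and as3_ideal_neg: "f \<in> as3_ideal \<Longrightarrow> - f \<in> as3_ideal"
    and as3_ideal_scale: "f \<in> as3_ideal \<Longrightarrow> na_scale c f \<in> as3_ideal"
    and as3_ideal_mult_right: "f \<in> as3_ideal \<Longrightarrow> f \<odot> g \<in> as3_ideal"
    and as3_ideal_mult_left: "f \<in> as3_ideal \<Longrightarrow> g \<odot> f \<in> as3_ideal"
proof -
  have sub: "nonassoc.subspace (as3_ideal :: ('a, 'b) nonassoc set)"
    and mult: "\<And>f g :: ('a, 'b) nonassoc. f \<in> as3_ideal \<Longrightarrow> f \<odot> g \<in> as3_ideal \<and> g \<odot> f \<in> as3_ideal"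
    using is_ideal_as3_ideal unfolding is_ideal_def by blast+
  show "0 \<in> (as3_ideal :: ('a, 'b) nonassoc set)"
    by (rule nonassoc.subspace_0[OF sub])
  show "f \<in> as3_ideal \<Longrightarrow> g \<in> as3_ideal \<Longrightarrow> f + g \<in> as3_ideal"
    by (rule nonassoc.subspace_add[OF sub])
  show "f \<in> as3_ideal \<Longrightarrow> g \<in> as3_ideal \<Longrightarrow> f - g \<in> as3_ideal"
    by (rule nonassoc.subspace_diff[OF sub])
  show "f \<in> as3_ideal \<Longrightarrow> - f \<in> as3_ideal"
    by (rule nonassoc.subspace_neg[OF sub])
  show "f \<in> as3_ideal \<Longrightarrow> na_scale c f \<in> as3_ideal"
    by (rule nonassoc.subspace_scale[OF sub])
  show "f \<in> as3_ideal \<Longrightarrow> f \<odot> g \<in> as3_ideal" "f \<in> as3_ideal \<Longrightarrow> g \<odot> f \<in> as3_ideal"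
    using mult by blast+
qed

quotient_type (overloaded) ('x, 'k) as3 = "('x, 'k::field) nonassoc" / as3_rel
proof (rule equivpI)
  show "reflp as3_rel" by (simp add: reflp_def as3_rel_def as3_ideal_0)
  show "symp as3_rel"
    unfolding symp_def as3_rel_def using as3_ideal_neg by (metis minus_diff_eq)
  show "transp (as3_rel :: ('x, 'k) nonassoc \<Rightarrow> _)"
  proof (rule transpI)
    fix f g h :: "('x, 'k) nonassoc"
    assume "as3_rel f g" "as3_rel g h"
    then have "(f - g) + (g - h) \<in> as3_ideal"
      unfolding as3_rel_def by (rule as3_ideal_add)
    then show "as3_rel f h" by (simp add: as3_rel_def)
  qed
qed

lemma as3_rel_refl: "as3_rel f f"
  by (simp add: as3_rel_def as3_ideal_0)

instantiation as3 :: (type, field) ring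
begin

lift_definition zero_as3 :: "('a, 'b) as3" is 0 .

lift_definition plus_as3 :: "('a, 'b) as3 \<Rightarrow> ('a, 'b) as3 \<Rightarrow> ('a, 'b) as3" is "(+)"
proof -
  fix f f' g g' :: "('a, 'b) nonassoc"
  assume "as3_rel f f'" "as3_rel g g'"
  then have "(f - f') + (g - g') \<in> as3_ideal"
    unfolding as3_rel_def by (rule as3_ideal_add)
  then show "as3_rel (f + g) (f' + g')"
    by (simp add: as3_rel_def add_diff_add)
qed

lift_definition uminus_as3 :: "('a, 'b) as3 \<Rightarrow> ('a, 'b) as3" is uminus
proof -
  fix f f' :: "('a, 'b) nonassoc"
  assume "as3_rel f f'"
  then have "- (f - f') \<in> as3_ideal"
    unfolding as3_rel_def by (rule as3_ideal_neg)
  then show "as3_rel (- f) (- f')"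
    by (simp add: as3_rel_def)
qed

lift_definition minus_as3 :: "('a, 'b) as3 \<Rightarrow> ('a, 'b) as3 \<Rightarrow> ('a, 'b) as3" is "(-)"
proof -
  fix f f' g g' :: "('a, 'b) nonassoc"
  assume "as3_rel f f'" "as3_rel g g'"
  then have "(f - f') - (g - g') \<in> as3_ideal"
    unfolding as3_rel_def by (rule as3_ideal_diff)
  moreover have "(f - f') - (g - g') = (f - g) - (f' - g')" by simp
  ultimately show "as3_rel (f - g) (f' - g')"
    by (simp only: as3_rel_def)
qed

lift_definition times_as3 :: "('a, 'b) as3 \<Rightarrow> ('a, 'b) as3 \<Rightarrow> ('a, 'b) as3" is "(\<odot>)"
proof -
  fix f f' g g' :: "('a, 'b) nonassoc"
  assume "as3_rel f f'" "as3_rel g g'"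
  then have "(f - f') \<odot> g + f' \<odot> (g - g') \<in> as3_ideal"
    unfolding as3_rel_def by (intro as3_ideal_add as3_ideal_mult_left as3_ideal_mult_right)
  then show "as3_rel (f \<odot> g) (f' \<odot> g')"
    by (simp add: as3_rel_def na_mult_diff_left na_mult_diff_right)
qed

instance
proof
  fix a b c :: "('a, 'b) as3"
  show "a * b * c = a * (b * c)"
  proof transfer
    fix f g h :: "('a, 'b) nonassoc"
    show "as3_rel (f \<odot> g \<odot> h) (f \<odot> (g \<odot> h))"
      unfolding as3_rel_def as3_ideal_def as3_relators_def
      by (rule subsetD[OF ideal_generated_superset]) blast
  qed
  show "a + b + c = a + (b + c)"
    by transfer (simp add: as3_rel_refl add.assoc)
  show "a + b = b + a"
    by transfer (simp add: as3_rel_refl add.commute)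
  show "0 + a = a"
    by transfer (simp add: as3_rel_refl)
  show "- a + a = 0"
    by transfer (simp add: as3_rel_refl)
  show "a - b = a + - b"
    by transfer (simp add: as3_rel_refl)
  show "(a + b) * c = a * c + b * c"
    by transfer (simp add: as3_rel_refl na_mult_add_left)
  show "a * (b + c) = a * b + a * c"
    by transfer (simp add: as3_rel_refl na_mult_add_right)
qed

end

lift_definition as3_scale :: "'k::field \<Rightarrow> ('x, 'k) as3 \<Rightarrow> ('x, 'k) as3" is na_scale
proof -
  fix c :: 'k and f f' :: "('x, 'k) nonassoc"
  assume "as3_rel f f'"
  then have "na_scale c (f - f') \<in> as3_ideal"
    unfolding as3_rel_def by (rule as3_ideal_scale)
  then show "as3_rel (na_scale c f) (na_scale c f')"
    by (simp add: as3_rel_def nonassoc.scale_right_diff_distrib)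
qed

interpretation as3: vector_space "as3_scale :: 'k::field \<Rightarrow> ('x, 'k) as3 \<Rightarrow> ('x, 'k) as3"
proof
  fix c d :: 'k and a b :: "('x, 'k) as3"
  show "as3_scale c (a + b) = as3_scale c a + as3_scale c b"
    by transfer (simp add: as3_rel_refl nonassoc.scale_right_distrib)
  show "as3_scale (c + d) a = as3_scale c a + as3_scale d a"
    by transfer (simp add: as3_rel_refl nonassoc.scale_left_distrib)
  show "as3_scale c (as3_scale d a) = as3_scale (c * d) a"
    by transfer (simp add: as3_rel_refl)
  show "as3_scale 1 a = a"
    by transfer (simp add: as3_rel_refl)
qed

lemma as3_scale_mult_left: "as3_scale c a * b = as3_scale c (a * b)"
  by transfer (simp add: as3_rel_refl na_mult_scale_left)

lemma as3_scale_mult_right: "a * as3_scale c b = as3_scale c (a * b)"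
  by transfer (simp add: as3_rel_refl na_mult_scale_right)

lemma as3_third_type:
  fixes a b c :: "('x, 'k::field) as3"
  shows "a * b * c + b * a * c - b * c * a - c * b * a = 0"
proof transfer
  fix f g h :: "('x, 'k) nonassoc"
  show "as3_rel (f \<odot> g \<odot> h + g \<odot> f \<odot> h - g \<odot> h \<odot> f - h \<odot> g \<odot> f) 0"
    unfolding as3_rel_def as3_ideal_def as3_relators_def diff_zero
    by (rule subsetD[OF ideal_generated_superset]) blast
qed

definition commutator :: "'a::ring \<Rightarrow> 'a \<Rightarrow> 'a" where
  "commutator a b = a * b - b * a"

section \<open>The identities\<close>

text \<open>
  Identities are elements of the free nonassociative algebra on countably many variables;
  its product \<open>\<odot>\<close> plays the role of the bracket.
\<close>

definition anticomm_id :: "(nat, 'k::field) nonassoc" where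
  "anticomm_id = na_var 0 \<odot> na_var 1 + na_var 1 \<odot> na_var 0"

definition jacobi_id :: "(nat, 'k::field) nonassoc" where
  "jacobi_id = na_var 0 \<odot> na_var 1 \<odot> na_var 2 + na_var 1 \<odot> na_var 2 \<odot> na_var 0
     + na_var 2 \<odot> na_var 0 \<odot> na_var 1"

definition nilpotent_id :: "(nat, 'k::field) nonassoc" where
  "nilpotent_id = na_var 0 \<odot> na_var 1 \<odot> na_var 2 \<odot> na_var 3"

end

theory Submission
  imports Defs "HOL-Library.Product_Plus"
begin

text \<open>
  Write \<open>a \<circ> b = ab + ba\<close>. The third-type identity says \<open>(a \<circ> b)c = (b \<circ> c)a\<close>, so
  \<open>(a \<circ> b)c\<close> is symmetric in its three arguments. Taking one of these arguments to be a product
  of two elements shows that a word of length four plus the word obtained by rotating its first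
  three letters is one of the elements \<open>(x \<circ> y)zw\<close>. Three rotations return to the original
  word, which therefore can be solved for (dividing by two), and it follows that all 24
  rearrangements of a product of four elements are equal (\<open>as3_words_commute\<close>). Expanding
  \<open>[[[a,b],c],d]\<close> into words of length four then gives zero, and anti-commutativity and the
  Jacobi identity hold for commutators in every associative algebra.

  For the converse let \<open>I\<close> be the T-ideal of the three identities. By anti-commutativity and the
  Jacobi identity every bracketing of four factors reduces to left-normed ones, hence lies in
  \<open>I\<close>. So a polynomial of degree at most four is congruent modulo \<open>I\<close> to a combination of
  \<open>X\<^sub>i\<close>, \<open>X\<^sub>iX\<^sub>j\<close> and \<open>(X\<^sub>iX\<^sub>j)X\<^sub>k\<close> (\<open>ex_normal_form\<close>), and if the polynomial is an
  identity then so is this combination. It remains to show that such an identity is in \<open>I\<close>,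
  that is, that in degree at most three there are only the identities of all Lie algebras.

  This is detected in a single algebra of dimension six, generated by two elements, which satisfies
  the third-type identity in the strong form \<open>(a \<circ> b)c = 0\<close>: with
  \<open>\<omega>(a,b) = a\<^sub>1b\<^sub>2 - a\<^sub>2b\<^sub>1\<close>, a product of three elements is \<open>\<omega>(a,b)c\<^sub>1\<close> and
  \<open>[[a,b],c] = 3\<omega>(a,b)c\<^sub>1\<close>. By the universal property of the free algebra an identity with two
  or more generators available vanishes when arbitrary vectors \<open>(s\<^sub>i, t\<^sub>i)\<close> are substituted for the
  variables (\<open>model_identity\<close>). The linear coefficients are then zero, the quadratic ones
  symmetric, and polarization of the cubic equation shows that the cubic ones, made antisymmetric in \<open>i, j\<close>,
  are invariant under cyclic shifts of \<open>i, j, k\<close>. Then twice the quadratic part is a combination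
  of instances of anti-commutativity, and six times the cubic part is one of consequences of
  anti-commutativity and instances of the Jacobi identity.
\<close>

section \<open>Evaluating nonassociative polynomials\<close>

lemma na_eval_superset:
  assumes "vector_space scale" "finite A" "Poly_Mapping.keys f \<subseteq> A"
  shows "na_eval scale mult \<sigma> f =
    (\<Sum>t\<in>A. scale (Poly_Mapping.lookup f t) (eval_magma mult \<sigma> t))"
proof -
  interpret vector_space scale by fact
  show ?thesis
    unfolding na_eval_def by (rule sum.mono_neutral_left) (use assms in \<open>auto simp: in_keys_iff\<close>)
qed

text \<open>
  Stated for bare functions, with no algebra structure on either side, so that one proof serves
  both composition of substitutions and the passage from the free third-type algebra to a model.
\<close>

lemma na_eval_hom:
  assumes add: "\<And>a b. h (a + b) = h a + h b"
    and scale: "\<And>c a. h (scale c a) = scale' c (h a)"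
    and mult: "\<And>a b. h (mult a b) = mult' (h a) (h b)"
  shows "h (na_eval scale mult \<sigma> f) = na_eval scale' mult' (\<lambda>v. h (\<sigma> v)) f"
proof -
  have zero: "h 0 = 0"
    using add[of 0 0] by simp
  have sum: "h (sum g A) = (\<Sum>x\<in>A. h (g x))" for g and A :: "'d magma set"
    by (induction A rule: infinite_finite_induct) (simp_all add: zero add)
  have "h (eval_magma mult \<sigma> t) = eval_magma mult' (\<lambda>v. h (\<sigma> v)) t" for t
    by (induction t) (simp_all add: mult)
  then show ?thesis
    by (simp add: na_eval_def sum scale)
qed

lemma nonassoc_expansion:
  "f = (\<Sum>t\<in>Poly_Mapping.keys f. na_scale (Poly_Mapping.lookup f t) (Poly_Mapping.single t 1))"
  by (rule poly_mapping_eqI)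
     (auto simp: na_scale_single lookup_sum lookup_single when_def in_keys_iff sum.delta')

lemma single_Mul: "Poly_Mapping.single (Mul s t) 1 = Poly_Mapping.single s (1 :: 'k::field) \<odot> Poly_Mapping.single t 1"
  by (simp add: na_mult_def)

locale bilinear_algebra = vector_space scale
  for scale :: "'k::field \<Rightarrow> 'a::ab_group_add \<Rightarrow> 'a" +
  fixes mult :: "'a \<Rightarrow> 'a \<Rightarrow> 'a"
  assumes mult_add_left: "mult (a + b) c = mult a c + mult b c"
    and mult_add_right: "mult c (a + b) = mult c a + mult c b"
    and mult_scale_left: "mult (scale r a) b = scale r (mult a b)"
    and mult_scale_right: "mult a (scale r b) = scale r (mult a b)"
begin

lemma mult_zero_left [simp]: "mult 0 a = 0"
  using mult_add_left[of 0 0 a] by simp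

lemma mult_zero_right [simp]: "mult a 0 = 0"
  using mult_add_right[of a 0 0] by simp

lemma mult_sum_left: "mult (sum g A) a = (\<Sum>x\<in>A. mult (g x) a)"
  by (induction A rule: infinite_finite_induct) (simp_all add: mult_add_left)

lemma mult_sum_right: "mult a (sum g A) = (\<Sum>x\<in>A. mult a (g x))"
  by (induction A rule: infinite_finite_induct) (simp_all add: mult_add_right)

lemma commutator_algebra: "bilinear_algebra scale (\<lambda>a b. mult a b - mult b a)"
  by unfold_locales
     (simp_all add: mult_add_left mult_add_right mult_scale_left mult_scale_right scale_right_diff_distrib)

lemma na_eval_zero [simp]: "na_eval scale mult \<sigma> 0 = 0"
  by (simp add: na_eval_def)

lemma na_eval_add: "na_eval scale mult \<sigma> (f + g) = na_eval scale mult \<sigma> f + na_eval scale mult \<sigma> g"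
proof -
  let ?A = "Poly_Mapping.keys f \<union> Poly_Mapping.keys g"
  have "Poly_Mapping.keys (f + g) \<subseteq> ?A" by (rule Poly_Mapping.keys_add)
  then show ?thesis
    by (simp add: na_eval_superset[OF vector_space_axioms, of ?A] lookup_add scale_left_distrib sum.distrib)
qed

lemma na_eval_scale: "na_eval scale mult \<sigma> (na_scale c f) = scale c (na_eval scale mult \<sigma> f)"
proof -
  have "Poly_Mapping.keys (na_scale c f) \<subseteq> Poly_Mapping.keys f" by (auto simp: in_keys_iff)
  then show ?thesis
    by (simp add: na_eval_superset[OF vector_space_axioms, of "Poly_Mapping.keys f"] scale_sum_right)
qed

lemma na_eval_minus: "na_eval scale mult \<sigma> (- f) = - na_eval scale mult \<sigma> f"
  using na_eval_add[of \<sigma> f "- f"] by (simp add: minus_unique)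

lemma na_eval_diff: "na_eval scale mult \<sigma> (f - g) = na_eval scale mult \<sigma> f - na_eval scale mult \<sigma> g"
  using na_eval_add[of \<sigma> f "- g"] by (simp add: na_eval_minus)

lemma na_eval_sum: "na_eval scale mult \<sigma> (sum g A) = (\<Sum>x\<in>A. na_eval scale mult \<sigma> (g x))"
  by (induction A rule: infinite_finite_induct) (simp_all add: na_eval_add)

lemma na_eval_single: "na_eval scale mult \<sigma> (Poly_Mapping.single t c) = scale c (eval_magma mult \<sigma> t)"
  by (cases "c = 0") (simp_all add: na_eval_def)

lemma na_eval_var: "na_eval scale mult \<sigma> (na_var v) = \<sigma> v"
  by (simp add: na_var_def na_eval_single)

lemma na_eval_mult: "na_eval scale mult \<sigma> (f \<odot> g) = mult (na_eval scale mult \<sigma> f) (na_eval scale mult \<sigma> g)"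
proof -
  have "na_eval scale mult \<sigma> (f \<odot> g) =
      (\<Sum>s\<in>Poly_Mapping.keys f. \<Sum>t\<in>Poly_Mapping.keys g.
         scale (Poly_Mapping.lookup f s * Poly_Mapping.lookup g t)
           (mult (eval_magma mult \<sigma> s) (eval_magma mult \<sigma> t)))"
    by (simp add: na_mult_def na_eval_sum na_eval_single)
  also have "\<dots> = mult (na_eval scale mult \<sigma> f) (na_eval scale mult \<sigma> g)"
    by (simp add: na_eval_def mult_sum_left mult_sum_right mult_scale_left mult_scale_right
        scale_sum_right sum.swap[of _ "Poly_Mapping.keys g"] mult.commute)
  finally show ?thesis .
qed

lemmas na_eval_simps = na_eval_add na_eval_diff na_eval_sum na_eval_scale na_eval_mult na_eval_var

lemma na_eval_substitution:
  "na_eval scale mult \<sigma> (na_eval na_scale (\<odot>) \<rho> f) = na_eval scale mult (\<lambda>v. na_eval scale mult \<sigma> (\<rho> v)) f"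
  by (rule na_eval_hom) (simp_all add: na_eval_simps)

lemma is_ideal_kernel: "is_ideal {f. na_eval scale mult \<sigma> f = 0}"
  by (auto simp: is_ideal_def nonassoc.subspace_def na_eval_simps)

text \<open>
  Closure under substitution holds because substituting and then evaluating is again an
  evaluation. So an identity stays an identity when it is changed by consequences of other identities.
\<close>

lemma is_T_ideal_identities: "is_T_ideal {f. is_identity scale mult f}"
  by (auto simp: is_T_ideal_def is_ideal_def nonassoc.subspace_def is_identity_def na_eval_simps
      na_eval_substitution)

end

interpretation nonassoc: bilinear_algebra na_scale "(\<odot>)"
  by unfold_locales (simp_all add: na_mult_add_left na_mult_add_right na_mult_scale_left na_mult_scale_right)

interpretation as3: bilinear_algebra as3_scale "(*)"
  by unfold_locales (simp_all add: algebra_simps as3_scale_mult_left as3_scale_mult_right)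

lemma commutator_eq: "commutator = (\<lambda>a b. a * b - b * a)"
  by (simp add: fun_eq_iff commutator_def)

interpretation as3_minus: bilinear_algebra as3_scale commutator
  unfolding commutator_eq by (rule as3.commutator_algebra)

section \<open>The universal property of the free third-type algebra\<close>

locale third_type_algebra = bilinear_algebra scale mult
  for scale :: "'k::field \<Rightarrow> 'a::ab_group_add \<Rightarrow> 'a" and mult +
  assumes mult_assoc: "mult (mult a b) c = mult a (mult b c)"
    and third_type:
      "mult (mult a b) c + mult (mult b a) c - mult (mult b c) a - mult (mult c b) a = 0"
begin

text \<open>
  The kernel of an evaluation is an ideal, and it contains the relators as soon as the target
  algebra satisfies the two defining identities.
\<close>

lemma na_eval_as3_ideal:
  assumes "f \<in> as3_ideal"
  shows "na_eval scale mult \<tau> f = 0"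
proof -
  have "as3_relators \<subseteq> {f. na_eval scale mult \<tau> f = 0}"
    by (auto simp: as3_relators_def na_eval_simps third_type) (simp add: mult_assoc)
  then have "as3_ideal \<subseteq> {f. na_eval scale mult \<tau> f = 0}"
    unfolding as3_ideal_def by (intro ideal_generated_minimal is_ideal_kernel)
  then show ?thesis using assms by blast
qed

definition as3_lift :: "('x \<Rightarrow> 'a) \<Rightarrow> ('x, 'k) as3 \<Rightarrow> 'a" where
  "as3_lift \<tau> a = na_eval scale mult \<tau> (rep_as3 a)"

lemma as3_lift_abs: "as3_lift \<tau> (abs_as3 f) = na_eval scale mult \<tau> f"
proof -
  have "as3_rel (rep_as3 (abs_as3 f)) f"
    by (rule Quotient_rep_abs[OF Quotient_as3 as3_rel_refl])
  then have "na_eval scale mult \<tau> (rep_as3 (abs_as3 f) - f) = 0"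
    unfolding as3_rel_def by (rule na_eval_as3_ideal)
  then show ?thesis
    by (simp add: as3_lift_def na_eval_diff)
qed

lemma as3_lift_add: "as3_lift \<tau> (a + b) = as3_lift \<tau> a + as3_lift \<tau> b"
  by (induction a; induction b) (simp add: plus_as3.abs_eq as3_lift_abs na_eval_add)

lemma as3_lift_scale: "as3_lift \<tau> (as3_scale c a) = scale c (as3_lift \<tau> a)"
  by (induction a) (simp add: as3_scale.abs_eq as3_lift_abs na_eval_scale)

lemma as3_lift_mult: "as3_lift \<tau> (a * b) = mult (as3_lift \<tau> a) (as3_lift \<tau> b)"
  by (induction a; induction b) (simp add: times_as3.abs_eq as3_lift_abs na_eval_mult)

lemma as3_lift_diff: "as3_lift \<tau> (a - b) = as3_lift \<tau> a - as3_lift \<tau> b"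
  by (metis add_diff_cancel_right' as3_lift_add diff_add_cancel)

lemma as3_lift_var: "as3_lift \<tau> (abs_as3 (na_var v)) = \<tau> v"
  by (simp add: as3_lift_abs na_eval_var)

text \<open>
  An identity for the commutator of the free algebra need not be one in every third-type algebra,
  since that algebra may need more generators. It does hold on the subalgebra generated by the
  values of \<open>\<tau>\<close>, which is the image of the lift.
\<close>

lemma as3_identity_transfer:
  fixes \<sigma> :: "nat \<Rightarrow> ('x, 'k) as3"
  assumes "is_identity (as3_scale :: 'k \<Rightarrow> ('x, 'k) as3 \<Rightarrow> ('x, 'k) as3) commutator f"
  shows "na_eval scale (\<lambda>a b. mult a b - mult b a) (\<lambda>i. as3_lift \<tau> (\<sigma> i)) f = 0"
proof -
  have "na_eval scale (\<lambda>a b. mult a b - mult b a) (\<lambda>i. as3_lift \<tau> (\<sigma> i)) f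
      = as3_lift \<tau> (na_eval as3_scale commutator \<sigma> f)"
    by (rule na_eval_hom[symmetric])
       (simp_all add: as3_lift_add as3_lift_scale as3_lift_mult as3_lift_diff commutator_def)
  also have "\<dots> = as3_lift \<tau> 0"
    using assms by (simp add: is_identity_def)
  also have "\<dots> = 0"
    using as3_lift_add[of \<tau> 0 0] by simp
  finally show ?thesis .
qed

end

section \<open>Products of four elements\<close>

lemma as3_double_cancel:
  fixes a b :: "('x, 'k::field_char_0) as3"
  assumes "a + a = b + b"
  shows "a = b"
proof -
  have "as3_scale 2 a = as3_scale 2 b"
    using assms by (metis as3.scale_left_distrib as3.scale_one one_add_one)
  then show ?thesis by simp
qed

lemma as3_jordan_swap:
  fixes a b c :: "('x, 'k::field) as3"
  shows "(a * b + b * a) * c = (b * c + c * b) * a"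
  using as3_third_type[of a b c] by (simp add: algebra_simps)

text \<open>
  This is \<open>(d \<circ> a)(bc) = (a \<circ> bc)d\<close>, the symmetry with the product \<open>bc\<close> as a single argument.
\<close>

lemma as3_rotate_sum:
  fixes a b c d :: "('x, 'k::field) as3"
  shows "a * b * c * d + b * c * a * d = (a * d + d * a) * b * c"
  using as3_third_type[of d a "b * c"] by (simp add: algebra_simps)

text \<open>
  The right-hand side is unchanged by permutations of its arguments, which is the source of the
  commutativity of words of length four.
\<close>

lemma as3_word_double:
  fixes a b c d :: "('x, 'k::field_char_0) as3"
  shows "a * b * c * d + a * b * c * d = (a * b + b * a) * c * d"
proof -
  define P where "P x y z e = (x * y + y * x) * z * e" for x y z e :: "('x, 'k) as3"
  have P_comm: "P x y z e = P y x z e" for x y z e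
    by (simp add: P_def add.commute)
  have P_rot: "P x y z e = P y z x e" for x y z e
    unfolding P_def using as3_jordan_swap[of x y z] by simp
  have rot: "x * y * z * e + y * z * x * e = P x e y z" for x y z e
    unfolding P_def by (rule as3_rotate_sum)
  \<comment> \<open>The three rotations of the first three letters give three equations in three words.\<close>
  have double: "x * y * z * e + x * y * z * e = P x e y z + P z e x y - P y e z x" for x y z e
  proof -
    have "x * y * z * e + x * y * z * e = (x * y * z * e + y * z * x * e)
        + (z * x * y * e + x * y * z * e) - (y * z * x * e + z * x * y * e)"
      by simp
    then show ?thesis by (simp only: rot)
  qed
  \<comment> \<open>Adding the formula for a word to that for the word with its first two letters exchanged.\<close>
  have last: "P x y z e = P x y e z" for x y z e
  proof (rule as3_double_cancel)
    have "P x y z e + P x y z e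
        = (x * y * z * e + x * y * z * e) + (y * x * z * e + y * x * z * e)"
      by (simp add: P_def algebra_simps)
    also have "\<dots> = (P x e y z + P z e x y - P y e z x) + (P y e x z + P z e y x - P x e z y)"
      by (simp only: double)
    also have "\<dots> = P x y e z + P x y e z"
      by (metis (no_types, lifting) P_comm P_rot add.commute add_diff_cancel_left' add_diff_eq diff_add_eq)
    finally show "P x y z e + P x y z e = P x y e z + P x y e z" .
  qed
  show ?thesis
    using double[of a b c d] P_comm P_rot last by (metis (no_types, lifting) P_def add_diff_cancel_right')
qed

lemma as3_words_commute:
  fixes a b c d :: "('x, 'k::field_char_0) as3"
  shows "a * b * c * d = b * a * c * d"
    and "a * b * c * d = a * c * b * d"
    and "a * b * c * d = a * b * d * c"
proof -
  have first: "x * y * z * e = y * x * z * e" for x y z e :: "('x, 'k) as3"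
    by (rule as3_double_cancel) (simp add: as3_word_double add.commute)
  have middle: "x * y * z * e = x * z * y * e" for x y z e :: "('x, 'k) as3"
  proof (rule as3_double_cancel)
    have "(x * y + y * x) * z * e = (z * x + x * z) * y * e"
      by (simp only: as3_jordan_swap[of z x y] add.commute[of "y * x"])
    then show "x * y * z * e + x * y * z * e = x * z * y * e + x * z * y * e"
      by (simp only: as3_word_double add.commute[of "x * z"])
  qed
  have "a * b * c * d + a * b * c * d = a * b * c * d + b * c * a * d"
    by (simp only: first[of a b] middle[of b a])
  also have "\<dots> = a * d * b * c + d * a * b * c"
    by (simp add: as3_rotate_sum distrib_right)
  also have "\<dots> = a * b * d * c + a * b * d * c"
    by (simp only: first[of d a] middle[of a d])
  finally show "a * b * c * d = a * b * d * c"
    by (rule as3_double_cancel)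
  show "a * b * c * d = b * a * c * d" "a * b * c * d = a * c * b * d"
    by (rule first, rule middle)
qed

lemma as3_commutator_nilpotent:
  fixes a b c d :: "('x, 'k::field_char_0) as3"
  shows "commutator (commutator (commutator a b) c) d = 0"
proof -
  note comm = as3_words_commute
  have "a * b * c * d = b * a * c * d" "c * a * b * d = c * b * a * d"
    "d * a * b * c = d * b * a * c" "d * c * a * b = d * c * b * a"
    by (rule comm(1), rule comm(2), rule comm(2), rule comm(3))
  then show ?thesis
    by (simp add: commutator_def algebra_simps)
qed

lemma as3_minus_identities:
  assumes "f \<in> {anticomm_id, jacobi_id, nilpotent_id}"
  shows "is_identity (as3_scale :: 'k::field_char_0 \<Rightarrow> ('x, 'k) as3 \<Rightarrow> ('x, 'k) as3) commutator f"
proof -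
  have "commutator a b + commutator b a = 0"
    "commutator (commutator a b) c + commutator (commutator b c) a + commutator (commutator c a) b = 0"
    for a b c :: "('x, 'k) as3"
    by (simp_all add: commutator_def algebra_simps)
  then show ?thesis
    using assms
    by (auto simp: is_identity_def anticomm_id_def jacobi_id_def nilpotent_id_def
        as3_minus.na_eval_simps as3_commutator_nilpotent)
qed

section \<open>A six-dimensional model with two generators\<close>

text \<open>
  Coordinates with respect to the basis \<open>x, y, xx, xy, yx, z\<close>, where \<open>z = xyx\<close>. The products
  \<open>yy\<close> and \<open>xxy\<close> are zero and \<open>yxx = -z\<close>, so that a product of three elements has only a
  \<open>z\<close>-coordinate, which is \<open>(a\<^sub>1b\<^sub>2 - a\<^sub>2b\<^sub>1)c\<^sub>1\<close>. Being alternating in its first two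
  arguments, it satisfies the third-type identity trivially.
\<close>

type_synonym 'k model = "'k \<times> 'k \<times> 'k \<times> 'k \<times> 'k \<times> 'k"

definition model_scale :: "'k::field \<Rightarrow> 'k model \<Rightarrow> 'k model" where
  "model_scale c = (\<lambda>(x, y, p, q, r, z). (c * x, c * y, c * p, c * q, c * r, c * z))"

definition model_mult :: "'k::field model \<Rightarrow> 'k model \<Rightarrow> 'k model" where
  "model_mult = (\<lambda>(x, y, p, q, r, z) (x', y', p', q', r', z').
     (0, 0, x * x', x * y', y * x', (q - r) * x' + x * r' - y * p'))"

interpretation model: third_type_algebra model_scale model_mult
  by unfold_locales
     (auto simp: model_scale_def model_mult_def algebra_simps zero_prod_def)

abbreviation model_comm :: "'k::field model \<Rightarrow> 'k model \<Rightarrow> 'k model" where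
  "model_comm a b \<equiv> model_mult a b - model_mult b a"

interpretation model_minus: bilinear_algebra model_scale model_comm
  by (rule model.commutator_algebra)

text \<open>
  Only the two generators are needed to reach all these vectors, which is where the hypothesis on
  \<open>'x\<close> enters.
\<close>

lemma model_identity:
  fixes f :: "(nat, 'k::field) nonassoc"
  assumes "\<exists>x y :: 'x. x \<noteq> y"
    and "is_identity (as3_scale :: 'k \<Rightarrow> ('x, 'k) as3 \<Rightarrow> ('x, 'k) as3) commutator f"
  shows "na_eval model_scale model_comm (\<lambda>i. (s i, t i, 0, 0, 0, 0)) f = 0"
proof -
  obtain x y :: 'x where "x \<noteq> y"
    using assms(1) by blast
  define \<tau> where "\<tau> = (\<lambda>v. if v = x then (1, 0, 0, 0, 0, 0) else (0, 1, 0, 0, 0, 0) :: 'k model)"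
  define \<sigma> where "\<sigma> i = as3_scale (s i) (abs_as3 (na_var x)) + as3_scale (t i) (abs_as3 (na_var y))" for i
  have "model.as3_lift \<tau> (\<sigma> i) = (s i, t i, 0, 0, 0, 0)" for i
    using \<open>x \<noteq> y\<close>
    by (simp add: \<sigma>_def model.as3_lift_add model.as3_lift_scale model.as3_lift_var \<tau>_def model_scale_def)
  then show ?thesis
    using model.as3_identity_transfer[OF assms(2), of \<tau> \<sigma>] by simp
qed

section \<open>Normal forms modulo the T-ideal\<close>

lemma is_T_ideal_T_ideal_generated: "is_T_ideal (T_ideal_generated S)"
  by (auto simp: is_T_ideal_def is_ideal_def T_ideal_generated_def intro!: nonassoc.subspace_Inter)

lemma T_ideal_generated_superset: "S \<subseteq> T_ideal_generated S"
  by (auto simp: T_ideal_generated_def)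

lemma T_ideal_generated_minimal: "is_T_ideal J \<Longrightarrow> S \<subseteq> J \<Longrightarrow> T_ideal_generated S \<subseteq> J"
  by (auto simp: T_ideal_generated_def)

definition lie_nil_ideal :: "(nat, 'k::field) nonassoc set" where
  "lie_nil_ideal = T_ideal_generated {anticomm_id, jacobi_id, nilpotent_id}"

lemma
  fixes f g :: "(nat, 'k::field) nonassoc"
  shows lie_nil_ideal_subspace: "nonassoc.subspace (lie_nil_ideal :: (nat, 'k) nonassoc set)"
    and lie_nil_ideal_mult_right: "f \<in> lie_nil_ideal \<Longrightarrow> f \<odot> g \<in> lie_nil_ideal"
    and lie_nil_ideal_substitution: "f \<in> lie_nil_ideal \<Longrightarrow> na_eval na_scale (\<odot>) \<rho> f \<in> lie_nil_ideal"
  using is_T_ideal_T_ideal_generated[of "{anticomm_id, jacobi_id, nilpotent_id} :: (nat, 'k) nonassoc set"]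
  by (auto simp: is_T_ideal_def is_ideal_def lie_nil_ideal_def)

lemmas lie_nil_ideal_add = nonassoc.subspace_add[OF lie_nil_ideal_subspace]
lemmas lie_nil_ideal_diff = nonassoc.subspace_diff[OF lie_nil_ideal_subspace]
lemmas lie_nil_ideal_scale = nonassoc.subspace_scale[OF lie_nil_ideal_subspace]
lemmas lie_nil_ideal_sum = nonassoc.subspace_sum[OF lie_nil_ideal_subspace]
lemmas lie_nil_ideal_0 = nonassoc.subspace_0[OF lie_nil_ideal_subspace]

lemma
  fixes p q r s :: "(nat, 'k::field) nonassoc"
  shows lie_nil_anticomm: "p \<odot> q + q \<odot> p \<in> lie_nil_ideal"
    and lie_nil_jacobi: "p \<odot> q \<odot> r + q \<odot> r \<odot> p + r \<odot> p \<odot> q \<in> lie_nil_ideal"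
    and lie_nil_nilpotent: "p \<odot> q \<odot> r \<odot> s \<in> lie_nil_ideal"
proof -
  define \<rho> where "\<rho> = (\<lambda>i::nat. if i = 0 then p else if i = 1 then q else if i = 2 then r else s)"
  have gen: "f \<in> {anticomm_id, jacobi_id, nilpotent_id} \<Longrightarrow> na_eval na_scale (\<odot>) \<rho> f \<in> lie_nil_ideal"
    for f
    by (rule lie_nil_ideal_substitution) (metis T_ideal_generated_superset lie_nil_ideal_def subsetD)
  show "p \<odot> q + q \<odot> p \<in> lie_nil_ideal"
    "p \<odot> q \<odot> r + q \<odot> r \<odot> p + r \<odot> p \<odot> q \<in> lie_nil_ideal" "p \<odot> q \<odot> r \<odot> s \<in> lie_nil_ideal"
    using gen[of anticomm_id] gen[of jacobi_id] gen[of nilpotent_id]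
    by (simp_all add: anticomm_id_def jacobi_id_def nilpotent_id_def nonassoc.na_eval_simps \<rho>_def)
qed

lemma lie_nil_ideal_identities:
  assumes "f \<in> lie_nil_ideal"
  shows "is_identity (as3_scale :: 'k::field_char_0 \<Rightarrow> ('x, 'k) as3 \<Rightarrow> ('x, 'k) as3) commutator f"
proof -
  have "lie_nil_ideal \<subseteq> {f. is_identity (as3_scale :: 'k \<Rightarrow> ('x, 'k) as3 \<Rightarrow> ('x, 'k) as3) commutator f}"
    unfolding lie_nil_ideal_def
    using as3_minus_identities
    by (intro T_ideal_generated_minimal as3_minus.is_T_ideal_identities) blast
  then show ?thesis using assms by blast
qed

lemma lie_nil_ideal_swap:
  "q \<odot> p \<in> lie_nil_ideal \<Longrightarrow> p \<odot> q \<in> lie_nil_ideal"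
  using lie_nil_ideal_diff[OF lie_nil_anticomm[of p q], of "q \<odot> p"] by simp

text \<open>
  The five bracketings of four factors. The first is the third generating identity itself; the
  others are brought to this shape by anti-commutativity and, for the last one, the Jacobi identity.
\<close>

lemma lie_nil_products:
  fixes p q r s :: "(nat, 'k::field) nonassoc"
  shows "p \<odot> q \<odot> r \<odot> s \<in> lie_nil_ideal"
    and "p \<odot> (q \<odot> r) \<odot> s \<in> lie_nil_ideal"
    and "s \<odot> (p \<odot> q \<odot> r) \<in> lie_nil_ideal"
    and "s \<odot> (p \<odot> (q \<odot> r)) \<in> lie_nil_ideal"
    and "p \<odot> q \<odot> (r \<odot> s) \<in> lie_nil_ideal"
proof -
  show left: "p \<odot> q \<odot> r \<odot> s \<in> lie_nil_ideal" for p q r s :: "(nat, 'k) nonassoc"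
    by (rule lie_nil_nilpotent)
  have "(p \<odot> (q \<odot> r) + q \<odot> r \<odot> p) \<odot> s - q \<odot> r \<odot> p \<odot> s \<in> lie_nil_ideal"
    by (intro lie_nil_ideal_diff lie_nil_ideal_mult_right lie_nil_anticomm left)
  then show right: "p \<odot> (q \<odot> r) \<odot> s \<in> lie_nil_ideal"
    by (simp add: na_mult_add_left)
  show "s \<odot> (p \<odot> q \<odot> r) \<in> lie_nil_ideal" "s \<odot> (p \<odot> (q \<odot> r)) \<in> lie_nil_ideal"
    by (rule lie_nil_ideal_swap, rule left, rule lie_nil_ideal_swap, rule right)
  \<comment> \<open>The Jacobi identity for \<open>r\<close>, \<open>s\<close> and the product \<open>p \<odot> q\<close>; its other two terms reduce to
    left-normed products.\<close>
  have "(r \<odot> s \<odot> (p \<odot> q) + s \<odot> (p \<odot> q) \<odot> r + p \<odot> q \<odot> r \<odot> s)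
      - (s \<odot> (p \<odot> q) + p \<odot> q \<odot> s) \<odot> r + p \<odot> q \<odot> s \<odot> r - p \<odot> q \<odot> r \<odot> s \<in> lie_nil_ideal"
    by (intro lie_nil_ideal_diff lie_nil_ideal_add lie_nil_ideal_mult_right lie_nil_anticomm left lie_nil_jacobi)
  then have "r \<odot> s \<odot> (p \<odot> q) \<in> lie_nil_ideal"
    by (simp add: na_mult_add_left)
  then show "p \<odot> q \<odot> (r \<odot> s) \<in> lie_nil_ideal"
    by (rule lie_nil_ideal_swap)
qed

lemma mdegree_pos: "0 < mdegree t"
  by (induction t) simp_all

lemma mdegree_1: "mdegree t = 1 \<longleftrightarrow> (\<exists>i. t = Var i)"
proof (cases t)
  case (Mul u v)
  then show ?thesis using mdegree_pos[of u] mdegree_pos[of v] by auto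
qed simp

lemma mdegree_Mul_cases:
  assumes "mdegree t = n" "1 < n"
  obtains u v where "t = Mul u v" "mdegree u + mdegree v = n" "0 < mdegree u" "0 < mdegree v"
proof (cases t)
  case (Mul u v)
  with assms(1) show ?thesis by (intro that[OF Mul] mdegree_pos) simp
qed (use assms in simp)

lemma mdegree_2:
  assumes "mdegree t = 2"
  shows "\<exists>i j. t = Mul (Var i) (Var j)"
proof -
  obtain u v where t: "t = Mul u v" and deg: "mdegree u + mdegree v = 2" "0 < mdegree u" "0 < mdegree v"
    using assms by (rule mdegree_Mul_cases) simp
  from deg have "mdegree u = 1" "mdegree v = 1"
    by linarith+
  then show ?thesis
    unfolding mdegree_1 t by blast
qed

lemma mdegree_3:
  assumes "mdegree t = 3"
  shows "\<exists>i j k. t = Mul (Mul (Var i) (Var j)) (Var k) \<or> t = Mul (Var k) (Mul (Var i) (Var j))"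
proof -
  obtain u v where t: "t = Mul u v" and deg: "mdegree u + mdegree v = 3" "0 < mdegree u" "0 < mdegree v"
    using assms by (rule mdegree_Mul_cases) simp
  from deg have "mdegree u = 1 \<and> mdegree v = 2 \<or> mdegree u = 2 \<and> mdegree v = 1"
    by linarith
  then show ?thesis
    using mdegree_1 mdegree_2 unfolding t by metis
qed

lemma lie_nil_degree_four:
  assumes "mdegree t = 4"
  shows "Poly_Mapping.single t (1 :: 'k::field) \<in> lie_nil_ideal"
proof -
  obtain u v where t: "t = Mul u v" and deg: "mdegree u + mdegree v = 4" "0 < mdegree u" "0 < mdegree v"
    using assms by (rule mdegree_Mul_cases) simp
  from deg consider "mdegree u = 1" "mdegree v = 3" | "mdegree u = 2" "mdegree v = 2"
    | "mdegree u = 3" "mdegree v = 1"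
    by linarith
  then show ?thesis
  proof cases
    case 1
    then show ?thesis
      using mdegree_3[of v] by (auto simp: t single_Mul lie_nil_products)
  next
    case 2
    then show ?thesis
      using mdegree_2[of u] mdegree_2[of v] by (auto simp: t single_Mul lie_nil_products)
  next
    case 3
    then show ?thesis
      using mdegree_3[of u] by (auto simp: t single_Mul lie_nil_products)
  qed
qed

definition normal_form ::
  "nat \<Rightarrow> (nat \<Rightarrow> 'k) \<Rightarrow> (nat \<Rightarrow> nat \<Rightarrow> 'k) \<Rightarrow> (nat \<Rightarrow> nat \<Rightarrow> nat \<Rightarrow> 'k) \<Rightarrow> (nat, 'k::field) nonassoc"
  where "normal_form n a b e =
    (\<Sum>i<n. na_scale (a i) (na_var i))
    + (\<Sum>i<n. \<Sum>j<n. na_scale (b i j) (na_var i \<odot> na_var j))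
    + (\<Sum>i<n. \<Sum>j<n. \<Sum>k<n. na_scale (e i j k) (na_var i \<odot> na_var j \<odot> na_var k))"

text \<open>
  The bound \<open>n\<close> on the variables is a parameter so that the property is closed under sums; the
  coefficients are not unique.
\<close>

definition has_normal_form :: "nat \<Rightarrow> (nat, 'k::field) nonassoc \<Rightarrow> bool" where
  "has_normal_form n f \<longleftrightarrow> (\<exists>a b e. f - normal_form n a b e \<in> lie_nil_ideal)"

lemma has_normal_form_ideal: "f \<in> lie_nil_ideal \<Longrightarrow> has_normal_form n f"
  unfolding has_normal_form_def
  by (rule exI[of _ "\<lambda>_. 0"], rule exI[of _ "\<lambda>_ _. 0"], rule exI[of _ "\<lambda>_ _ _. 0"])
     (simp add: normal_form_def)

lemma has_normal_form_add:
  assumes "has_normal_form n f" "has_normal_form n g"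
  shows "has_normal_form n (f + g)"
proof -
  obtain a b e a' b' e' where
    "f - normal_form n a b e \<in> lie_nil_ideal" "g - normal_form n a' b' e' \<in> lie_nil_ideal"
    using assms unfolding has_normal_form_def by blast
  then have "(f - normal_form n a b e) + (g - normal_form n a' b' e') \<in> lie_nil_ideal"
    by (rule lie_nil_ideal_add)
  also have "(f - normal_form n a b e) + (g - normal_form n a' b' e') = f + g -
     normal_form n (\<lambda>i. a i + a' i) (\<lambda>i j. b i j + b' i j) (\<lambda>i j k. e i j k + e' i j k)"
    by (simp add: normal_form_def nonassoc.scale_left_distrib sum.distrib algebra_simps)
  finally show ?thesis
    unfolding has_normal_form_def by blast
qed

lemma has_normal_form_scale:
  assumes "has_normal_form n f"
  shows "has_normal_form n (na_scale c f)"
proof -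
  obtain a b e where "f - normal_form n a b e \<in> lie_nil_ideal"
    using assms unfolding has_normal_form_def by blast
  then have "na_scale c (f - normal_form n a b e) \<in> lie_nil_ideal"
    by (rule lie_nil_ideal_scale)
  also have "na_scale c (f - normal_form n a b e) = na_scale c f -
     normal_form n (\<lambda>i. c * a i) (\<lambda>i j. c * b i j) (\<lambda>i j k. c * e i j k)"
    by (simp add: normal_form_def nonassoc.scale_right_diff_distrib nonassoc.scale_right_distrib
        nonassoc.scale_sum_right)
  finally show ?thesis
    unfolding has_normal_form_def by blast
qed

lemma has_normal_form_sum:
  "(\<And>x. x \<in> A \<Longrightarrow> has_normal_form n (g x)) \<Longrightarrow> has_normal_form n (sum g A)"
  by (induction A rule: infinite_finite_induct)
     (auto intro: has_normal_form_add has_normal_form_ideal lie_nil_ideal_0)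

lemma sum_scale_of_bool:
  "i < n \<Longrightarrow> (\<Sum>l<n. na_scale (of_bool (l = i)) (g l)) = g i" for n :: nat
proof -
  assume "i < n"
  moreover have "na_scale (of_bool (l = i)) (g l) = (if l = i then g l else 0)" for l
    by simp
  ultimately show ?thesis
    by (simp only: sum.delta finite_lessThan lessThan_iff if_True)
qed

lemma has_normal_form_var:
  assumes "i < n"
  shows "has_normal_form n (na_var i :: (nat, 'k::field) nonassoc)"
proof -
  have "normal_form n (\<lambda>l. of_bool (l = i)) (\<lambda>_ _. 0) (\<lambda>_ _ _. 0) = (na_var i :: (nat, 'k) nonassoc)"
    using assms by (simp add: normal_form_def sum_scale_of_bool del: of_bool_eq)
  then show ?thesis
    unfolding has_normal_form_def by (metis diff_self lie_nil_ideal_0)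
qed

lemma has_normal_form_product2:
  assumes "i < n" "j < n"
  shows "has_normal_form n (na_var i \<odot> na_var j :: (nat, 'k::field) nonassoc)"
proof -
  have "(\<Sum>l<n. \<Sum>m<n. na_scale (of_bool (l = i) * of_bool (m = j)) (na_var l \<odot> na_var m))
      = (na_var i \<odot> na_var j :: (nat, 'k) nonassoc)"
    by (simp only: nonassoc.scale_scale[symmetric] nonassoc.scale_sum_right[symmetric]
        sum_scale_of_bool assms)
  then have "normal_form n (\<lambda>_. 0) (\<lambda>l m. of_bool (l = i) * of_bool (m = j)) (\<lambda>_ _ _. 0)
      = (na_var i \<odot> na_var j :: (nat, 'k) nonassoc)"
    by (simp only: normal_form_def nonassoc.scale_zero_left sum.neutral_const add_0_left add_0_right)
  then show ?thesis
    unfolding has_normal_form_def by (metis diff_self lie_nil_ideal_0)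
qed

lemma has_normal_form_product3:
  assumes "i < n" "j < n" "k < n"
  shows "has_normal_form n (na_var i \<odot> na_var j \<odot> na_var k :: (nat, 'k::field) nonassoc)"
proof -
  have "(\<Sum>l<n. \<Sum>m<n. \<Sum>h<n. na_scale (of_bool (l = i) * (of_bool (m = j) * of_bool (h = k)))
        (na_var l \<odot> na_var m \<odot> na_var h))
      = (na_var i \<odot> na_var j \<odot> na_var k :: (nat, 'k) nonassoc)"
    by (simp only: nonassoc.scale_scale[symmetric] nonassoc.scale_sum_right[symmetric]
        sum_scale_of_bool assms)
  then have "normal_form n (\<lambda>_. 0) (\<lambda>_ _. 0) (\<lambda>l m h. of_bool (l = i) * (of_bool (m = j) * of_bool (h = k)))
      = (na_var i \<odot> na_var j \<odot> na_var k :: (nat, 'k) nonassoc)"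
    by (simp only: normal_form_def nonassoc.scale_zero_left sum.neutral_const add_0_left add_0_right)
  then show ?thesis
    unfolding has_normal_form_def by (metis diff_self lie_nil_ideal_0)
qed

lemma has_normal_form_product3':
  assumes "i < n" "j < n" "k < n"
  shows "has_normal_form n (na_var k \<odot> (na_var i \<odot> na_var j) :: (nat, 'k::field) nonassoc)"
proof -
  let ?p = "na_var i \<odot> na_var j :: (nat, 'k) nonassoc"
  have "has_normal_form n ((na_var k \<odot> ?p + ?p \<odot> na_var k) + na_scale (-1) (?p \<odot> na_var k))"
    by (rule has_normal_form_add[OF has_normal_form_ideal[OF lie_nil_anticomm]
          has_normal_form_scale[OF has_normal_form_product3[OF assms]]])
  then show ?thesis by simp
qed

lemma has_normal_form_monomial:
  assumes "mdegree t \<le> 4" "set_magma t \<subseteq> {..<n}"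
  shows "has_normal_form n (Poly_Mapping.single t (1 :: 'k::field))"
proof -
  have var: "Poly_Mapping.single (Var i) (1 :: 'k) = na_var i" for i
    by (simp add: na_var_def)
  from assms(1) mdegree_pos[of t] consider "mdegree t = 1" | "mdegree t = 2" | "mdegree t = 3" | "mdegree t = 4"
    by linarith
  then show ?thesis
  proof cases
    case 1
    then show ?thesis using assms(2) unfolding mdegree_1
      by (auto simp: var has_normal_form_var)
  next
    case 2
    then show ?thesis using assms(2)
      by (auto dest!: mdegree_2 simp: single_Mul var has_normal_form_product2)
  next
    case 3
    then show ?thesis using assms(2)
      by (auto dest!: mdegree_3 simp: single_Mul var has_normal_form_product3 has_normal_form_product3')
  next
    case 4
    then show ?thesis
      by (intro has_normal_form_ideal lie_nil_degree_four)
  qed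
qed

lemma ex_normal_form:
  assumes "\<forall>t \<in> Poly_Mapping.keys f. mdegree t \<le> 4"
  shows "\<exists>n. has_normal_form n f"
proof -
  have fin: "finite (set_magma t)" for t :: "nat magma"
    by (induction t) simp_all
  then have "finite (\<Union>t\<in>Poly_Mapping.keys f. set_magma t)"
    by simp
  then obtain n where "\<forall>i\<in>(\<Union>t\<in>Poly_Mapping.keys f. set_magma t). i < n"
    unfolding finite_nat_set_iff_bounded by blast
  then have n: "set_magma t \<subseteq> {..<n}" if "t \<in> Poly_Mapping.keys f" for t
    using that by blast
  have "has_normal_form n (\<Sum>t\<in>Poly_Mapping.keys f. na_scale (Poly_Mapping.lookup f t) (Poly_Mapping.single t 1))"
    using assms n by (intro has_normal_form_sum has_normal_form_scale has_normal_form_monomial) auto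
  then show ?thesis
    by (metis nonassoc_expansion)
qed

section \<open>Identities in normal form\<close>

text \<open>
  The three equations are the coordinates at \<open>x\<close>, \<open>xy\<close> and \<open>z\<close> of the value in the model. The last
  one carries a factor 3, which is cancelled.
\<close>

lemma model_identity_normal_form:
  fixes s t :: "nat \<Rightarrow> 'k::field_char_0"
  assumes "na_eval model_scale model_comm (\<lambda>i. (s i, t i, 0, 0, 0, 0)) (normal_form n a b e) = 0"
  shows "(\<Sum>i<n. a i * s i) = 0"
    and "(\<Sum>i<n. \<Sum>j<n. b i j * (s i * t j - t i * s j)) = 0"
    and "(\<Sum>i<n. \<Sum>j<n. \<Sum>k<n. e i j k * ((s i * t j - t i * s j) * s k)) = 0"
proof -
  have sum_tuple: "(\<Sum>i\<in>A. (f1 i, f2 i, f3 i, f4 i, f5 i, f6 i)) = (sum f1 A, sum f2 A, sum f3 A, sum f4 A, sum f5 A, sum f6 A)"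
    for f1 f2 f3 f4 f5 f6 :: "nat \<Rightarrow> 'k" and A
    by (simp add: sum_prod)
  let ?w = "\<lambda>i j. s i * t j - t i * s j"
  have comm2: "model_comm (s i, t i, 0, 0, 0, 0) (s j, t j, 0, 0, 0, 0) = (0, 0, 0, ?w i j, - ?w i j, 0)"
    for i j
    by (simp add: model_mult_def algebra_simps)
  have comm3: "model_comm (0, 0, 0, ?w i j, - ?w i j, 0) (s k, t k, 0, 0, 0, 0) = (0, 0, 0, 0, 0, 3 * (?w i j * s k))"
    for i j k
    by (simp add: model_mult_def algebra_simps)
  have "na_eval model_scale model_comm (\<lambda>i. (s i, t i, 0, 0, 0, 0)) (normal_form n a b e) =
    ((\<Sum>i<n. a i * s i), (\<Sum>i<n. a i * t i), 0, (\<Sum>i<n. \<Sum>j<n. b i j * ?w i j),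
      (\<Sum>i<n. \<Sum>j<n. b i j * - ?w i j), (\<Sum>i<n. \<Sum>j<n. \<Sum>k<n. e i j k * (3 * (?w i j * s k))))"
    unfolding normal_form_def model_minus.na_eval_simps comm2 comm3
    by (simp add: model_scale_def sum_tuple)
  then have "(\<Sum>i<n. a i * s i) = 0" "(\<Sum>i<n. \<Sum>j<n. b i j * ?w i j) = 0"
    "(\<Sum>i<n. \<Sum>j<n. \<Sum>k<n. e i j k * (3 * (?w i j * s k))) = 0"
    using assms by (simp_all add: zero_prod_def)
  moreover have "(\<Sum>i<n. \<Sum>j<n. \<Sum>k<n. e i j k * (3 * (?w i j * s k)))
      = 3 * (\<Sum>i<n. \<Sum>j<n. \<Sum>k<n. e i j k * (?w i j * s k))"
    by (simp add: sum_distrib_left mult.left_commute)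
  ultimately show "(\<Sum>i<n. a i * s i) = 0" "(\<Sum>i<n. \<Sum>j<n. b i j * ?w i j) = 0"
    "(\<Sum>i<n. \<Sum>j<n. \<Sum>k<n. e i j k * (?w i j * s k)) = 0"
    by simp_all
qed


lemma sum_of_bool: "i < n \<Longrightarrow> (\<Sum>l<n. f l * of_bool (l = i)) = (f i :: 'k::field)" for n :: nat
  by (simp add: of_bool_def if_distrib cong: if_cong)

lemma vanishing_linear_form:
  fixes a :: "nat \<Rightarrow> 'k::field"
  assumes "\<And>s. (\<Sum>i<n. a i * s i) = 0" "i < n"
  shows "a i = 0"
  using assms(1)[of "\<lambda>l. of_bool (l = i)"] assms(2) by (simp only: sum_of_bool)

lemma vanishing_alternating_form:
  fixes b :: "nat \<Rightarrow> nat \<Rightarrow> 'k::field"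
  assumes "\<And>s t. (\<Sum>i<n. \<Sum>j<n. b i j * (s i * t j - t i * s j)) = 0" "i < n" "j < n"
  shows "b i j = b j i"
proof -
  define s t where "s l = (of_bool (l = i) :: 'k)" and "t l = (of_bool (l = j) :: 'k)" for l
  have "(\<Sum>l<n. \<Sum>m<n. b l m * (s l * t m - t l * s m))
      = (\<Sum>l<n. (\<Sum>m<n. b l m * t m) * s l) - (\<Sum>l<n. (\<Sum>m<n. b l m * s m) * t l)"
    by (simp add: sum_distrib_left sum_distrib_right sum_subtractf[symmetric] algebra_simps)
  also have "\<dots> = b i j - b j i"
    by (simp only: s_def t_def sum_of_bool assms(2,3))
  finally show ?thesis
    using assms(1) by simp
qed

text \<open>
  With \<open>E i j k = e i j k - e j i k\<close> the hypothesis says that the trilinear form \<open>T\<close> with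
  coefficients \<open>E\<close> vanishes whenever its first and third arguments agree. Hence \<open>E\<close> is antisymmetric
  in its first and third index, and as it is antisymmetric in the first two, it is cyclic. The
  argument is uniform, with no distinction of cases when indices coincide.
\<close>

lemma vanishing_mixed_form:
  fixes e :: "nat \<Rightarrow> nat \<Rightarrow> nat \<Rightarrow> 'k::field"
  assumes "\<And>s t. (\<Sum>i<n. \<Sum>j<n. \<Sum>k<n. e i j k * ((s i * t j - t i * s j) * s k)) = 0"
    and "i < n" "j < n" "k < n"
  shows "e i j k - e j i k = e j k i - e k j i"
proof -
  define E where "E i j k = e i j k - e j i k" for i j k
  define T where "T s t u = (\<Sum>i<n. \<Sum>j<n. \<Sum>k<n. E i j k * u k * t j * s i)" for s t u :: "nat \<Rightarrow> 'k"
  have vanish: "T s t s = 0" for s t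
  proof -
    have "T s t s = (\<Sum>i<n. \<Sum>j<n. \<Sum>k<n. e i j k * (s i * t j * s k))
        - (\<Sum>i<n. \<Sum>j<n. \<Sum>k<n. e j i k * (s i * t j * s k))"
      by (simp add: T_def E_def sum_subtractf[symmetric] algebra_simps)
    also have "(\<Sum>i<n. \<Sum>j<n. \<Sum>k<n. e j i k * (s i * t j * s k))
        = (\<Sum>i<n. \<Sum>j<n. \<Sum>k<n. e i j k * (t i * s j * s k))"
      by (subst sum.swap) (simp add: mult.commute)
    finally show ?thesis
      using assms(1)[of s t] by (simp add: sum_subtractf algebra_simps)
  qed
  define \<delta> where "\<delta> l = (\<lambda>m. of_bool (m = l) :: 'k)" for l :: nat
  have basis: "T (\<delta> l) (\<delta> m) (\<delta> h) = E l m h" if "l < n" "m < n" "h < n" for l m h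
    by (simp only: T_def \<delta>_def sum_distrib_right[symmetric] sum_of_bool that)
  have "T (\<lambda>l. \<delta> i l + \<delta> k l) (\<delta> j) (\<lambda>l. \<delta> i l + \<delta> k l)
      = T (\<delta> i) (\<delta> j) (\<delta> i) + T (\<delta> i) (\<delta> j) (\<delta> k) + T (\<delta> k) (\<delta> j) (\<delta> i) + T (\<delta> k) (\<delta> j) (\<delta> k)"
    by (simp add: T_def sum.distrib algebra_simps)
  then have "T (\<delta> i) (\<delta> j) (\<delta> k) + T (\<delta> k) (\<delta> j) (\<delta> i) = 0"
    by (simp add: vanish)
  then have "E i j k + E k j i = 0"
    by (simp only: basis assms)
  then show ?thesis
    by (simp add: E_def algebra_simps)
qed

lemma lie_nil_ideal_cancel_scale:
  assumes "na_scale c f \<in> lie_nil_ideal" "c \<noteq> 0"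
  shows "f \<in> lie_nil_ideal"
  using lie_nil_ideal_scale[OF assms(1), of "inverse c"] assms(2) by simp

lemma scale_two: "na_scale 2 f = f + f"
  unfolding one_add_one[symmetric] nonassoc.scale_left_distrib nonassoc.scale_one ..

text \<open>
  Twice the sum pairs each \<open>X\<^sub>iX\<^sub>j\<close> with \<open>X\<^sub>jX\<^sub>i\<close>.
\<close>

lemma lie_nil_symmetric_sum:
  fixes b :: "nat \<Rightarrow> nat \<Rightarrow> 'k::field_char_0"
  assumes "\<And>i j. i < n \<Longrightarrow> j < n \<Longrightarrow> b i j = b j i"
  shows "(\<Sum>i<n. \<Sum>j<n. na_scale (b i j) (na_var i \<odot> na_var j)) \<in> lie_nil_ideal"
proof -
  let ?S = "\<Sum>i<n. \<Sum>j<n. na_scale (b i j) (na_var i \<odot> na_var j)"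
  have "?S = (\<Sum>i<n. \<Sum>j<n. na_scale (b j i) (na_var j \<odot> na_var i))"
    by (rule sum.swap)
  also have "\<dots> = (\<Sum>i<n. \<Sum>j<n. na_scale (b i j) (na_var j \<odot> na_var i))"
    by (intro sum.cong refl) (use assms in fastforce)
  finally have "?S + ?S = (\<Sum>i<n. \<Sum>j<n. na_scale (b i j) (na_var i \<odot> na_var j + na_var j \<odot> na_var i))"
    by (simp add: nonassoc.scale_right_distrib sum.distrib)
  also have "\<dots> \<in> lie_nil_ideal"
    by (intro lie_nil_ideal_sum lie_nil_ideal_scale lie_nil_anticomm)
  finally have "na_scale 2 ?S \<in> lie_nil_ideal"
    by (simp only: scale_two)
  then show ?thesis
    by (rule lie_nil_ideal_cancel_scale) simp
qed

lemma sum_rotate: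
  "(\<Sum>i<n. \<Sum>j<n. \<Sum>k<n. g i j k) = (\<Sum>i<n. \<Sum>j<n. \<Sum>k<n. g j k i)"
  for g :: "nat \<Rightarrow> nat \<Rightarrow> nat \<Rightarrow> 'b::comm_monoid_add"
proof -
  have "(\<Sum>i<n. \<Sum>j<n. \<Sum>k<n. g j k i) = (\<Sum>j<n. \<Sum>i<n. \<Sum>k<n. g j k i)"
    by (rule sum.swap)
  also have "\<dots> = (\<Sum>j<n. \<Sum>k<n. \<Sum>i<n. g j k i)"
    by (rule sum.cong[OF refl sum.swap])
  finally show ?thesis ..
qed

text \<open>
  Anti-commutativity replaces twice the sum by the same sum with coefficients
  \<open>e i j k - e j i k\<close>. These are cyclic, so three times that sum is a combination of Jacobi expressions.
\<close>

lemma lie_nil_cyclic_sum: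
  fixes e :: "nat \<Rightarrow> nat \<Rightarrow> nat \<Rightarrow> 'k::field_char_0"
  assumes "\<And>i j k. i < n \<Longrightarrow> j < n \<Longrightarrow> k < n \<Longrightarrow> e i j k - e j i k = e j k i - e k j i"
  shows "(\<Sum>i<n. \<Sum>j<n. \<Sum>k<n. na_scale (e i j k) (na_var i \<odot> na_var j \<odot> na_var k)) \<in> lie_nil_ideal"
proof -
  define E where "E i j k = e i j k - e j i k" for i j k
  define M where "M i j k = na_var i \<odot> na_var j \<odot> (na_var k :: (nat, 'k) nonassoc)" for i j k
  define S where "S g = (\<Sum>i<n. \<Sum>j<n. \<Sum>k<n. na_scale (e i j k) (g i j k))"
    for g :: "nat \<Rightarrow> nat \<Rightarrow> nat \<Rightarrow> (nat, 'k) nonassoc"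
  define S' where "S' g = (\<Sum>i<n. \<Sum>j<n. \<Sum>k<n. na_scale (E i j k) (g i j k))"
    for g :: "nat \<Rightarrow> nat \<Rightarrow> nat \<Rightarrow> (nat, 'k) nonassoc"
  have cyclic: "E i j k = E j k i" if "i < n" "j < n" "k < n" for i j k
    using assms[OF that] by (simp add: E_def)
  have rotate: "S' g = S' (\<lambda>i j k. g j k i)" for g
    unfolding S'_def by (subst sum_rotate, intro sum.cong refl) (simp add: cyclic[symmetric])
  have "S' M + S' M + S' M = S' (\<lambda>i j k. M i j k + M j k i + M k i j)"
    using rotate[of M] rotate[of "\<lambda>i j k. M j k i"]
    by (simp add: S'_def nonassoc.scale_right_distrib sum.distrib)
  also have "\<dots> \<in> lie_nil_ideal"
    unfolding S'_def M_def by (intro lie_nil_ideal_sum lie_nil_ideal_scale lie_nil_jacobi)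
  finally have three: "S' M + S' M + S' M \<in> lie_nil_ideal" .
  have "(\<Sum>i<n. \<Sum>j<n. \<Sum>k<n. na_scale (e j i k) (M i j k)) = S (\<lambda>i j k. M j i k)"
    unfolding S_def by (rule sum.swap)
  then have S': "S' M = S M - S (\<lambda>i j k. M j i k)"
    by (simp add: S'_def S_def E_def nonassoc.scale_left_diff_distrib sum_subtractf)
  have anti: "S (\<lambda>i j k. M i j k + M j i k) \<in> lie_nil_ideal"
    unfolding S_def M_def na_mult_add_left[symmetric]
    by (intro lie_nil_ideal_sum lie_nil_ideal_scale lie_nil_ideal_mult_right lie_nil_anticomm)
  have "S (\<lambda>i j k. M i j k + M j i k) = S M + S (\<lambda>i j k. M j i k)"
    by (simp add: S_def nonassoc.scale_right_distrib sum.distrib)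
  then have "S M + S M = S (\<lambda>i j k. M i j k + M j i k) + S' M"
    by (simp add: S')
  moreover have "S' M \<in> lie_nil_ideal"
  proof (rule lie_nil_ideal_cancel_scale)
    have "na_scale 3 (S' M) = na_scale (1 + 1 + 1) (S' M)"
      by simp
    also have "\<dots> = S' M + S' M + S' M"
      by (simp only: nonassoc.scale_left_distrib nonassoc.scale_one)
    finally show "na_scale 3 (S' M) \<in> lie_nil_ideal"
      using three by simp
  qed simp
  ultimately have "na_scale 2 (S M) \<in> lie_nil_ideal"
    using anti by (simp add: scale_two lie_nil_ideal_add)
  then have "S M \<in> lie_nil_ideal"
    by (rule lie_nil_ideal_cancel_scale) simp
  then show ?thesis
    by (simp add: S_def M_def)
qed

lemma normal_form_identity:
  fixes a :: "nat \<Rightarrow> 'k::field_char_0"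
  assumes "\<exists>x y :: 'x. x \<noteq> y"
    and "is_identity (as3_scale :: 'k \<Rightarrow> ('x, 'k) as3 \<Rightarrow> ('x, 'k) as3) commutator (normal_form n a b e)"
  shows "normal_form n a b e \<in> lie_nil_ideal"
proof -
  note zero = model_identity_normal_form[OF model_identity[OF assms]]
  have "(\<Sum>i<n. na_scale (a i) (na_var i)) = 0"
    by (rule sum.neutral) (simp add: vanishing_linear_form[OF zero(1)])
  moreover have "(\<Sum>i<n. \<Sum>j<n. na_scale (b i j) (na_var i \<odot> na_var j)) \<in> lie_nil_ideal"
    by (rule lie_nil_symmetric_sum) (rule vanishing_alternating_form[OF zero(2)])
  moreover have "(\<Sum>i<n. \<Sum>j<n. \<Sum>k<n. na_scale (e i j k) (na_var i \<odot> na_var j \<odot> na_var k)) \<in> lie_nil_ideal"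
    by (rule lie_nil_cyclic_sum) (rule vanishing_mixed_form[OF zero(3)])
  ultimately show ?thesis
    by (simp add: normal_form_def lie_nil_ideal_add)
qed

text \<open>
  Passing to the normal form keeps the property of being an identity, because the three generating
  identities hold for the commutator of the free algebra.
\<close>

lemma low_degree_identity:
  fixes f :: "(nat, 'k::field_char_0) nonassoc"
  assumes "\<exists>x y :: 'x. x \<noteq> y"
    and "\<forall>t \<in> Poly_Mapping.keys f. mdegree t \<le> 4"
    and "is_identity (as3_scale :: 'k \<Rightarrow> ('x, 'k) as3 \<Rightarrow> ('x, 'k) as3) commutator f"
  shows "f \<in> lie_nil_ideal"
proof -
  obtain n where "has_normal_form n f"
    using ex_normal_form[OF assms(2)] ..
  then obtain a b e where nf: "f - normal_form n a b e \<in> lie_nil_ideal"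
    unfolding has_normal_form_def by blast
  then have "is_identity (as3_scale :: 'k \<Rightarrow> ('x, 'k) as3 \<Rightarrow> ('x, 'k) as3) commutator (f - normal_form n a b e)"
    by (rule lie_nil_ideal_identities)
  then have "is_identity (as3_scale :: 'k \<Rightarrow> ('x, 'k) as3 \<Rightarrow> ('x, 'k) as3) commutator (normal_form n a b e)"
    using assms(3) by (simp add: is_identity_def as3_minus.na_eval_diff)
  then have "normal_form n a b e \<in> lie_nil_ideal"
    by (rule normal_form_identity[OF assms(1)])
  then show ?thesis
    using lie_nil_ideal_add[OF nf, of "normal_form n a b e"] by simp
qed

theorem theorem7:
  shows "(\<forall>f \<in> {anticomm_id, jacobi_id, nilpotent_id}.
            is_identity (as3_scale :: 'k::field_char_0 \<Rightarrow> ('x, 'k) as3 \<Rightarrow> ('x, 'k) as3) commutator f)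
       \<and> ((\<exists>x y :: 'x. x \<noteq> y) \<longrightarrow>
          (\<forall>f :: (nat, 'k) nonassoc.
             (\<forall>t \<in> Poly_Mapping.keys f. mdegree t \<le> 4)
             \<and> is_identity (as3_scale :: 'k \<Rightarrow> ('x, 'k) as3 \<Rightarrow> ('x, 'k) as3) commutator f
             \<longrightarrow> f \<in> T_ideal_generated {anticomm_id, jacobi_id, nilpotent_id}))"
proof (intro conjI ballI impI allI)
  fix f :: "(nat, 'k) nonassoc"
  assume "f \<in> {anticomm_id, jacobi_id, nilpotent_id}"
  then show "is_identity (as3_scale :: 'k \<Rightarrow> ('x, 'k) as3 \<Rightarrow> ('x, 'k) as3) commutator f"
    by (rule as3_minus_identities)
next
  fix f :: "(nat, 'k) nonassoc"
  assume "\<exists>x y :: 'x. x \<noteq> y"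
    and "(\<forall>t \<in> Poly_Mapping.keys f. mdegree t \<le> 4)
      \<and> is_identity (as3_scale :: 'k \<Rightarrow> ('x, 'k) as3 \<Rightarrow> ('x, 'k) as3) commutator f"
  then show "f \<in> T_ideal_generated {anticomm_id, jacobi_id, nilpotent_id}"
    unfolding lie_nil_ideal_def[symmetric]
    by (elim conjE) (rule low_degree_identity)
qed

end
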